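(* Let $\mathcal{C}$ be a sum-closed permutation class, and let $\mathcal{A}$ be the set of sum-indecomposable permutations belonging to $\mathcal{C}$. Suppose that $\mathcal{C}$ is supercritical and that $\mathcal{C}$ contains an incompatible pair. Then $\mathcal{C}$ has an exponential Wilf collapse, unless $\mathcal{C}$ is the class of increasing permutations (i.e., the class of permutations avoiding $21$).
   Context: Permutations are considered in one-line notation; $|\pi|$ is the size of $\pi$. A permutation $\tau$ contains $\pi$ if some subsequence of $\tau$ is order-isomorphic to $\pi$. A permutation class is a set of permutations closed downward under containment. The sum $\alpha\oplus\beta$ of permutations $\alpha$ (of size $a$) and $\beta$ is the concatenation of $\alpha$ with $\beta$ shifted up by $a$ in every entry. A permutation is sum-indecomposable if it is not a sum of two nonempty permutations; every permutation is uniquely a sum $\alpha_1\oplus\cdots\oplus\alpha_k$ of sum-indecomposables. A class $\mathcal{C}$ is sum-closed if $\alpha,\beta\in\mathcal{C}$ implies $\alpha\oplus\beta\in\mathcal{C}$. Let $A(x)=\sum_{a\in\mathcal{A}}x^{|a|}$ with radius of convergence $\rho_A$; $\mathcal{C}$ is supercritical if $\lim_{x\to\rho_A^-}A(x)>1$. An ordered pair $(a,b)$ of elements of $\mathcal{A}$ is incompatible if there is no $c\in\mathcal{A}$ that contains $a\oplus b$. For $\alpha,\beta\in\mathcal{C}$, $\alpha$ and $\beta$ are Wilf-equivalent in $\mathcal{C}$ if for every $n$ the number of permutations of size $n$ in $\mathcal{C}$ avoiding $\alpha$ equals the number of those avoiding $\beta$. Let $c_n$ be the number of permutations of size $n$ in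 $\mathcal{C}$ and $w_n$ the number of Wilf-equivalence classes (in $\mathcal{C}$) into which the permutations of size $n$ in $\mathcal{C}$ fall. $\mathcal{C}$ has an exponential Wilf collapse if there is $r<1$ with $w_n=o(r^n c_n)$. *)

theory Defs
  imports
    "HOL-Analysis.FPS_Convergence"
    "HOL-Combinatorics.Multiset_Permutations"
    "HOL-Library.Sublist"
    "HOL-Library.Landau_Symbols"
begin

text \<open>
  Permutations are written in one-line notation, as lists over the entries 1, ..., n.
  The empty permutation is allowed; the size of a permutation is its \<^term>\<open>length\<close>.
\<close>

definition permutation :: "nat list \<Rightarrow> bool" where
  "permutation \<pi> \<longleftrightarrow> \<pi> \<in> permutations_of_set {1..length \<pi>}"

definition order_isomorphic :: "nat list \<Rightarrow> nat list \<Rightarrow> bool" where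
  "order_isomorphic xs ys \<longleftrightarrow>
     length xs = length ys \<and>
     (\<forall>i<length xs. \<forall>j<length xs. xs ! i < xs ! j \<longleftrightarrow> ys ! i < ys ! j)"

definition contains :: "nat list \<Rightarrow> nat list \<Rightarrow> bool" where
  "contains \<tau> \<pi> \<longleftrightarrow> (\<exists>\<sigma>. subseq \<sigma> \<tau> \<and> order_isomorphic \<sigma> \<pi>)"

definition perm_class :: "nat list set \<Rightarrow> bool" where
  "perm_class C \<longleftrightarrow>
     (\<forall>\<tau>\<in>C. permutation \<tau>) \<and>
     (\<forall>\<tau>\<in>C. \<forall>\<pi>. permutation \<pi> \<and> contains \<tau> \<pi> \<longrightarrow> \<pi> \<in> C)"

definition Av :: "nat list \<Rightarrow> nat list set" where
  "Av \<pi> = {\<tau>. permutation \<tau> \<and> \<not> contains \<tau> \<pi>}"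

definition perm_sum :: "nat list \<Rightarrow> nat list \<Rightarrow> nat list" (infixl \<open>\<oplus>\<close> 65) where
  "\<alpha> \<oplus> \<beta> = \<alpha> @ map (\<lambda>x. x + length \<alpha>) \<beta>"

definition sum_closed :: "nat list set \<Rightarrow> bool" where
  "sum_closed C \<longleftrightarrow> (\<forall>\<alpha>\<in>C. \<forall>\<beta>\<in>C. \<alpha> \<oplus> \<beta> \<in> C)"

text \<open>
  The empty permutation does not count as sum-indecomposable: this is what makes the
  decomposition into sum-indecomposables unique.
\<close>

definition sum_indecomposable :: "nat list \<Rightarrow> bool" where
  "sum_indecomposable \<pi> \<longleftrightarrow>
     permutation \<pi> \<and> \<pi> \<noteq> [] \<and>
     \<not> (\<exists>\<alpha> \<beta>. permutation \<alpha> \<and> permutation \<beta> \<and> \<alpha> \<noteq> [] \<and> \<beta> \<noteq> [] \<and> \<pi> = \<alpha> \<oplus> \<beta>)"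

definition indecomposables :: "nat list set \<Rightarrow> nat list set" where
  "indecomposables C = {\<pi>\<in>C. sum_indecomposable \<pi>}"

definition of_size :: "nat list set \<Rightarrow> nat \<Rightarrow> nat list set" where
  "of_size X n = {\<pi>\<in>X. length \<pi> = n}"

text \<open>The series of \<open>x ^ length a\<close> over all \<open>a \<in> X\<close>, collected by size.\<close>

definition gen_fun :: "nat list set \<Rightarrow> real fps" where
  "gen_fun X = Abs_fps (\<lambda>n. real (card (of_size X n)))"

text \<open>
  Both the radius of convergence and the limit may be infinite, so the limit from the left
  is taken in the extended reals. If the radius of convergence is 0, there is no such limit
  to speak of, and the class is not supercritical.
\<close>

definition supercritical :: "nat list set \<Rightarrow> bool" where
  "supercritical C \<longleftrightarrow>
     (let A = gen_fun (indecomposables C); \<rho> = fps_conv_radius A in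
       \<rho> > 0 \<and>
       (\<exists>L::ereal. ((\<lambda>x::ereal. ereal (eval_fps A (real_of_ereal x))) \<longlongrightarrow> L) (at_left \<rho>) \<and> L > 1))"

definition incompatible :: "nat list set \<Rightarrow> nat list \<Rightarrow> nat list \<Rightarrow> bool" where
  "incompatible C a b \<longleftrightarrow>
     a \<in> indecomposables C \<and> b \<in> indecomposables C \<and>
     \<not> (\<exists>c\<in>indecomposables C. contains c (a \<oplus> b))"

definition wilf_equivalence :: "nat list set \<Rightarrow> (nat list \<times> nat list) set" where
  "wilf_equivalence C =
     {(\<alpha>, \<beta>). \<alpha> \<in> C \<and> \<beta> \<in> C \<and>
        (\<forall>n. card (of_size (C \<inter> Av \<alpha>) n) = card (of_size (C \<inter> Av \<beta>) n))}"

definition num_wilf_classes :: "nat list set \<Rightarrow> nat \<Rightarrow> nat" where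
  "num_wilf_classes C n = card (of_size C n // wilf_equivalence C)"

text \<open>The base \<open>r\<close> has to be positive: a base below \<open>-1\<close> would make the condition void.\<close>

definition exponential_wilf_collapse :: "nat list set \<Rightarrow> bool" where
  "exponential_wilf_collapse C \<longleftrightarrow>
     (\<exists>r::real. 0 < r \<and> r < 1 \<and>
        (\<lambda>n. real (num_wilf_classes C n)) \<in> o(\<lambda>n. r ^ n * real (card (of_size C n))))"

end

theory Submission
  imports Defs
begin

text \<open>
  Write the members of \<open>C\<close> as words over the alphabet of sum-indecomposables, and let \<open>(a, b)\<close> be
  incompatible. An occurrence of a word \<open>\<dots>a\<close> followed by a word \<open>b\<dots>\<close> splits at a letter boundary,
  because no letter contains \<open>a \<oplus> b\<close>. A word containing \<open>s\<close> is uniquely a minimal such word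
  followed by an arbitrary word, so the generating functions \<open>F\<close> of words containing a given word
  satisfy \<open>F [] * F (s s') = F s * F s'\<close> whenever \<open>s\<close> ends in \<open>a\<close> and \<open>s'\<close> begins with \<open>b\<close>.
  Hence two adjacent blocks \<open>b u a\<close> and \<open>b v a\<close>, preceded by \<open>a\<close> and followed by \<open>b\<close>, can be swapped
  without leaving the Wilf class. For a letter \<open>c \<noteq> a\<close> the swap turning \<open>W = abcabab\<close> into \<open>ababcab\<close>
  lowers the sum of the positions of \<open>a\<close>, so every Wilf class has a member without the factor \<open>W\<close>.

  Let \<open>A x\<^sub>0 = 1\<close>. Cutting words into chunks of seven letters, none of which equals \<open>W\<close>, shows that
  the generating function of the words without factor \<open>W\<close> converges where \<open>A x ^ 7 - x ^ \<bar>W\<bar> < 1\<close>,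
  in particular for some \<open>x > x\<^sub>0\<close>. On the other hand \<open>c\<^sub>n\<close> is at least a constant times \<open>y ^ -n\<close> as soon
  as \<open>A y > 1\<close>, which holds for some \<open>y\<close> strictly between \<open>x\<^sub>0\<close> and \<open>x\<close>.
\<close>

section \<open>Sums and containment\<close>

lemma permutation_iff: "permutation \<pi> \<longleftrightarrow> distinct \<pi> \<and> set \<pi> = {1..length \<pi>}"
  by (auto simp: permutation_def permutations_of_set_def)

lemma length_perm_sum [simp]: "length (\<alpha> \<oplus> \<beta>) = length \<alpha> + length \<beta>"
  by (simp add: perm_sum_def)

lemma perm_sum_Nil [simp]: "\<alpha> \<oplus> [] = \<alpha>" "[] \<oplus> \<alpha> = \<alpha>"
  by (simp_all add: perm_sum_def)

lemma perm_sum_assoc: "\<alpha> \<oplus> \<beta> \<oplus> \<gamma> = \<alpha> \<oplus> (\<beta> \<oplus> \<gamma>)"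
  by (simp add: perm_sum_def add.assoc add.commute)

lemma permutation_perm_sum:
  assumes "permutation \<alpha>" "permutation \<beta>"
  shows "permutation (\<alpha> \<oplus> \<beta>)"
proof -
  have "(\<lambda>x. x + length \<alpha>) ` {1..length \<beta>} = {length \<alpha> + 1..length \<alpha> + length \<beta>}"
    by (simp add: add.commute)
  then show ?thesis
    using assms by (auto simp: permutation_iff perm_sum_def distinct_map)
qed

lemma perm_sum_cancel: "length \<alpha> = length \<alpha>' \<Longrightarrow> \<alpha> \<oplus> \<beta> = \<alpha>' \<oplus> \<beta>' \<Longrightarrow> \<alpha> = \<alpha>' \<and> \<beta> = \<beta>'"
  by (simp add: perm_sum_def inj_map_eq_map inj_def)

text \<open>If the first \<open>k\<close> entries are smaller than all later ones, their values form
  a down-set of size \<open>k\<close> and hence are exactly 1, ..., \<open>k\<close>. This turns a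
  comparison of positions into a sum decomposition.\<close>

lemma permutation_cut:
  assumes \<pi>: "permutation \<pi>" and k: "k \<le> length \<pi>"
    and less: "\<And>i j. i < k \<Longrightarrow> k \<le> j \<Longrightarrow> j < length \<pi> \<Longrightarrow> \<pi> ! i < \<pi> ! j"
  shows "permutation (take k \<pi>)" "permutation (map (\<lambda>x. x - k) (drop k \<pi>))"
    "\<pi> = take k \<pi> \<oplus> map (\<lambda>x. x - k) (drop k \<pi>)"
proof -
  let ?S = "set (take k \<pi>)" and ?T = "set (drop k \<pi>)"
  have dist: "distinct \<pi>" and set: "?S \<union> ?T = {1..length \<pi>}"
    using \<pi> by (auto simp: permutation_iff simp flip: set_append)
  have lt: "s < t" if st: "s \<in> ?S" "t \<in> ?T" for s t
  proof -
    obtain i where "i < k" "s = \<pi> ! i" using st(1) k by (auto simp: in_set_conv_nth)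
    moreover obtain j where "j < length \<pi> - k" "t = \<pi> ! (k + j)"
      using st(2) k by (auto simp: in_set_conv_nth)
    ultimately show ?thesis using less[of i "k + j"] by auto
  qed
  have cardS: "card ?S = k" using dist k by (simp add: distinct_card)
  have "?S \<subseteq> {1..k}"
  proof
    fix s assume s: "s \<in> ?S"
    then have sn: "s \<in> {1..length \<pi>}" using set by blast
    \<comment> \<open>The values of \<open>?T\<close> exceed \<open>s\<close>, so \<open>?S\<close>
      is closed downward; then \<open>s\<close> is at most its cardinality \<open>k\<close>.\<close>
    have "{1..s} \<subseteq> ?S"
    proof
      fix z assume z: "z \<in> {1..s}"
      then have "z \<in> ?S \<union> ?T" using sn unfolding set by auto
      then show "z \<in> ?S" using lt[OF s, of z] z by auto
    qed
    from card_mono[OF _ this] show "s \<in> {1..k}" using sn cardS by simp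
  qed
  then have S: "?S = {1..k}"
    using cardS by (intro card_subset_eq) auto
  have disj: "?S \<inter> ?T = {}" using lt by blast
  then have "?T = {1..length \<pi>} - {1..k}" using set unfolding S by blast
  also have "\<dots> = {k+1..length \<pi>}" by auto
  finally have T: "?T = {k+1..length \<pi>}" .
  show "permutation (take k \<pi>)"
    using S dist k by (simp add: permutation_iff)
  have "(\<lambda>x. x - k) ` {k+1..length \<pi>} = {1..length \<pi> - k}"
  proof
    show "{1..length \<pi> - k} \<subseteq> (\<lambda>x. x - k) ` {k+1..length \<pi>}"
      by (rule subsetI, rule_tac x = "x + k" in image_eqI) auto
  qed auto
  moreover have "inj_on (\<lambda>x. x - k) ?T"
    unfolding T by (auto simp: inj_on_def)
  ultimately show "permutation (map (\<lambda>x. x - k) (drop k \<pi>))"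
    using T dist by (auto simp: permutation_iff distinct_map)
  have "map (\<lambda>x. x - k + k) (drop k \<pi>) = drop k \<pi>"
    using T by (intro map_idI) auto
  then show "\<pi> = take k \<pi> \<oplus> map (\<lambda>x. x - k) (drop k \<pi>)"
    using k by (simp add: perm_sum_def o_def min_def)
qed

section \<open>Unique decomposition into sum-indecomposables\<close>

lemma perm_sum_nth_less:
  assumes "permutation \<alpha>" "permutation \<beta>" "i < length \<alpha>" "length \<alpha> \<le> j" "j < length (\<alpha> \<oplus> \<beta>)"
  shows "(\<alpha> \<oplus> \<beta>) ! i < (\<alpha> \<oplus> \<beta>) ! j"
proof -
  have "\<alpha> ! i \<in> set \<alpha>" using assms by simp
  then have "\<alpha> ! i \<le> length \<alpha>" using assms(1) by (simp add: permutation_iff)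
  moreover have "\<beta> ! (j - length \<alpha>) \<in> set \<beta>" using assms by simp
  then have "0 < \<beta> ! (j - length \<alpha>)" using assms(2) by (simp add: permutation_iff)
  ultimately show ?thesis using assms by (simp add: perm_sum_def nth_append)
qed

text \<open>If \<open>\<alpha>'\<close> were longer than \<open>\<alpha>\<close>, the cut of the
  common sum after \<open>\<alpha>\<close> would also cut \<open>\<alpha>'\<close> into two nonempty
  summands. Applied in both directions, this makes the first summands equally long.\<close>

lemma sum_indecomposable_perm_sum_length_le:
  assumes \<alpha>: "sum_indecomposable \<alpha>" and \<beta>: "permutation \<beta>"
    and \<alpha>': "sum_indecomposable \<alpha>'" and \<beta>': "permutation \<beta>'"
    and eq: "\<alpha> \<oplus> \<beta> = \<alpha>' \<oplus> \<beta>'"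
  shows "length \<alpha>' \<le> length \<alpha>"
proof (rule ccontr)
  let ?k = "length \<alpha>"
  assume long: "\<not> length \<alpha>' \<le> ?k"
  have pref: "\<alpha>' ! i = (\<alpha> \<oplus> \<beta>) ! i" if "i < length \<alpha>'" for i
    using that unfolding eq by (simp add: perm_sum_def nth_append)
  have le: "length \<alpha>' \<le> length (\<alpha> \<oplus> \<beta>)" unfolding eq by simp
  have less: "\<alpha>' ! i < \<alpha>' ! j" if "i < ?k" "?k \<le> j" "j < length \<alpha>'" for i j
    using that long le \<alpha> \<beta> by (auto simp: pref sum_indecomposable_def intro!: perm_sum_nth_less)
  have perm: "permutation \<alpha>'" using \<alpha>' by (simp add: sum_indecomposable_def)
  note cut = permutation_cut[OF perm _ less, of ?k]
  have "take ?k \<alpha>' \<noteq> []" "map (\<lambda>x. x - ?k) (drop ?k \<alpha>') \<noteq> []"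
    using long \<alpha> by (auto simp: sum_indecomposable_def)
  then show False using cut long \<alpha>' unfolding sum_indecomposable_def by (meson nat_le_linear)
qed

lemma sum_indecomposable_perm_sum_eqD:
  assumes "sum_indecomposable \<alpha>" "permutation \<beta>" "sum_indecomposable \<alpha>'" "permutation \<beta>'"
    and "\<alpha> \<oplus> \<beta> = \<alpha>' \<oplus> \<beta>'"
  shows "\<alpha> = \<alpha>' \<and> \<beta> = \<beta>'"
  using assms by (intro perm_sum_cancel antisym) (auto intro: sum_indecomposable_perm_sum_length_le)

primrec perm_sums :: "nat list list \<Rightarrow> nat list" where
  "perm_sums [] = []"
| "perm_sums (\<alpha> # w) = \<alpha> \<oplus> perm_sums w"

lemma perm_sums_append [simp]: "perm_sums (v @ w) = perm_sums v \<oplus> perm_sums w"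
  by (induction v) (simp_all add: perm_sum_assoc)

lemma length_perm_sums: "length (perm_sums w) = sum_list (map length w)"
  by (induction w) simp_all

lemma permutation_Nil [simp]: "permutation []"
  by (simp add: permutation_iff)

lemma permutation_perm_sums: "w \<in> lists {\<pi>. permutation \<pi>} \<Longrightarrow> permutation (perm_sums w)"
  by (induction w) (auto intro: permutation_perm_sum)

lemma lists_indecomposable_permutation:
  "w \<in> lists {\<pi>. sum_indecomposable \<pi>} \<Longrightarrow> permutation (perm_sums w)"
  by (rule permutation_perm_sums) (auto simp: sum_indecomposable_def)

text \<open>Uniqueness of the decomposition: the first letters agree by
  \<open>sum_indecomposable_perm_sum_eqD\<close>, and the induction handles the remaining
  sums.\<close>

lemma inj_on_perm_sums: "inj_on perm_sums (lists {\<pi>. sum_indecomposable \<pi>})"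
proof (rule inj_onI)
  fix v w :: "nat list list"
  assume "v \<in> lists {\<pi>. sum_indecomposable \<pi>}" "w \<in> lists {\<pi>. sum_indecomposable \<pi>}"
    "perm_sums v = perm_sums w"
  then show "v = w"
  proof (induction v arbitrary: w)
    case Nil
    then show ?case by (cases w) (auto simp: perm_sum_def sum_indecomposable_def)
  next
    case (Cons \<alpha> v)
    then obtain \<beta> u where w: "w = \<beta> # u"
      by (cases w) (auto simp: perm_sum_def sum_indecomposable_def)
    have "\<alpha> = \<beta> \<and> perm_sums v = perm_sums u"
      using Cons.hyps Cons.prems unfolding w
      by (intro sum_indecomposable_perm_sum_eqD) (auto intro: lists_indecomposable_permutation)
    then show ?case using Cons.IH[of u] Cons.prems(1) w by simp
  qed
qed

lemma permutation_decompose: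
  assumes "permutation \<pi>"
  obtains w where "w \<in> lists {\<pi>. sum_indecomposable \<pi>}" "\<pi> = perm_sums w"
  using assms
proof (induction \<pi> arbitrary: thesis rule: length_induct)
  case (1 \<pi>)
  consider "\<pi> = []" | "sum_indecomposable \<pi>"
    | \<alpha> \<beta> where "permutation \<alpha>" "permutation \<beta>" "\<alpha> \<noteq> []" "\<beta> \<noteq> []" "\<pi> = \<alpha> \<oplus> \<beta>"
    using "1.prems"(2) by (auto simp: sum_indecomposable_def)
  then show ?case
  proof cases
    case 1
    then show ?thesis using "1.prems"(1)[of "[]"] by simp
  next
    case 2
    then show ?thesis using "1.prems"(1)[of "[\<pi>]"] by simp
  next
    case 3
    then have "length \<alpha> < length \<pi>" "length \<beta> < length \<pi>" by simp_all
    with 3 "1.IH" obtain v w where "v \<in> lists {\<pi>. sum_indecomposable \<pi>}" "\<alpha> = perm_sums v"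
      "w \<in> lists {\<pi>. sum_indecomposable \<pi>}" "\<beta> = perm_sums w" by metis
    then show ?thesis using "1.prems"(1)[of "v @ w"] 3 by auto
  qed
qed

section \<open>Order isomorphism and containment of sums\<close>

lemma order_isomorphic_nth:
  "order_isomorphic xs ys \<Longrightarrow> i < length xs \<Longrightarrow> j < length xs \<Longrightarrow> xs ! i < xs ! j \<longleftrightarrow> ys ! i < ys ! j"
  by (auto simp: order_isomorphic_def)

lemma order_isomorphic_refl: "order_isomorphic xs xs"
  by (simp add: order_isomorphic_def)

lemma order_isomorphic_trans:
  "order_isomorphic xs ys \<Longrightarrow> order_isomorphic ys zs \<Longrightarrow> order_isomorphic xs zs"
  by (simp add: order_isomorphic_def)

lemma order_isomorphic_subseq:
  assumes iso: "order_isomorphic xs ys" and sub: "subseq zs ys"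
  shows "\<exists>us. subseq us xs \<and> order_isomorphic us zs"
proof -
  obtain N where N: "zs = nths ys N" using sub by (auto simp: subseq_conv_nths)
  \<comment> \<open>Zipping lets the single index set \<open>N\<close> select corresponding entries
    of both lists.\<close>
  define P where "P = zip xs ys"
  have len: "length xs = length ys" using iso by (simp add: order_isomorphic_def)
  have P: "map fst P = xs" "map snd P = ys" by (simp_all add: P_def len)
  have gen: "fst p < fst q \<longleftrightarrow> snd p < snd q" if "p \<in> set P" "q \<in> set P" for p q
    using that iso by (auto simp: P_def in_set_conv_nth order_isomorphic_def)
  let ?Q = "nths P N"
  have mem: "?Q ! i \<in> set P" if "i < length ?Q" for i
    using that by (intro in_set_nthsD[of _ P N] nth_mem)
  have "subseq (map fst ?Q) xs"
    by (metis P(1) nths_map subseq_conv_nths)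
  moreover have "map snd ?Q = zs" using N P(2) by (metis nths_map)
  moreover have "order_isomorphic (map fst ?Q) (map snd ?Q)"
    unfolding order_isomorphic_def
    by (auto simp: gen[OF mem mem])
  ultimately show ?thesis by metis
qed

lemma subseq_set_subset: "subseq xs ys \<Longrightarrow> set xs \<subseteq> set ys"
  by (auto simp: subseq_conv_nths dest: in_set_nthsD)

lemma contains_trans:
  assumes "contains \<rho> \<sigma>" "contains \<sigma> \<tau>"
  shows "contains \<rho> \<tau>"
proof -
  obtain us vs where "subseq us \<rho>" "order_isomorphic us \<sigma>" "subseq vs \<sigma>" "order_isomorphic vs \<tau>"
    using assms by (auto simp: contains_def)
  then show ?thesis unfolding contains_def
    by (meson order_isomorphic_subseq order_isomorphic_trans subseq_order.trans)
qed

lemma order_isomorphic_map_add: "order_isomorphic (map (\<lambda>x. x + k) xs) xs"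
  by (simp add: order_isomorphic_def)

lemma contains_Nil [simp]: "contains \<tau> []"
  by (auto simp: contains_def order_isomorphic_def)

lemma contains_Nil_left_iff [simp]: "contains [] \<pi> \<longleftrightarrow> \<pi> = []"
  by (auto simp: contains_def order_isomorphic_def dest!: subseq_set_subset)

lemma contains_perm_sum_left: "contains (\<alpha> \<oplus> \<beta>) \<alpha>"
  unfolding contains_def perm_sum_def
  by (rule exI[of _ \<alpha>]) (auto intro: order_isomorphic_refl)

lemma contains_perm_sum_right: "contains (\<alpha> \<oplus> \<beta>) \<beta>"
  unfolding contains_def perm_sum_def
  by (rule exI[of _ "map (\<lambda>x. x + length \<alpha>) \<beta>"]) (auto intro: order_isomorphic_map_add)

lemma contains_perm_sumI:
  assumes perm: "permutation \<alpha>" "permutation \<beta>" "permutation \<pi>" "permutation \<rho>"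
    and "contains \<alpha> \<pi>" "contains \<beta> \<rho>"
  shows "contains (\<alpha> \<oplus> \<beta>) (\<pi> \<oplus> \<rho>)"
proof -
  obtain us vs where us: "subseq us \<alpha>" "order_isomorphic us \<pi>"
    and vs: "subseq vs \<beta>" "order_isomorphic vs \<rho>"
    using assms by (auto simp: contains_def)
  have len: "length us = length \<pi>" "length vs = length \<rho>"
    using us vs by (auto simp: order_isomorphic_def)
  let ?w = "us @ map (\<lambda>x. x + length \<alpha>) vs"
  have "subseq ?w (\<alpha> \<oplus> \<beta>)"
    unfolding perm_sum_def by (intro list_emb_append_mono subseq_map us vs)
  moreover have cross: "?w ! i < ?w ! j" if "i < length us" "length us \<le> j" "j < length ?w" for i j
  proof -
    have "us ! i \<in> set \<alpha>" using that by (intro subseq_set_subset[THEN subsetD, OF us(1)] nth_mem)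
    then have "us ! i \<le> length \<alpha>" using perm by (simp add: permutation_iff)
    moreover have "vs ! (j - length us) \<in> set \<beta>"
      using that by (intro subseq_set_subset[THEN subsetD, OF vs(1)] nth_mem) auto
    then have "0 < vs ! (j - length us)" using perm by (simp add: permutation_iff)
    ultimately show ?thesis using that by (simp add: nth_append)
  qed
  have cross': "(\<pi> \<oplus> \<rho>) ! i < (\<pi> \<oplus> \<rho>) ! j" if "i < length us" "length us \<le> j" "j < length ?w" for i j
    using that perm len by (intro perm_sum_nth_less) auto
  have "order_isomorphic ?w (\<pi> \<oplus> \<rho>)"
    unfolding order_isomorphic_def
  proof (intro conjI allI impI)
    show "length ?w = length (\<pi> \<oplus> \<rho>)" by (simp add: len)
    fix i j assume ij: "i < length ?w" "j < length ?w"
    \<comment> \<open>Within a block the comparison is inherited from one of the two given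
      occurrences; across blocks the left entry is the smaller one on both sides.\<close>
    consider "i < length us" "j < length us" | "i < length us" "length us \<le> j"
      | "length us \<le> i" "j < length us" | "length us \<le> i" "length us \<le> j" by linarith
    then show "?w ! i < ?w ! j \<longleftrightarrow> (\<pi> \<oplus> \<rho>) ! i < (\<pi> \<oplus> \<rho>) ! j"
    proof cases
      case 1
      then show ?thesis using us(2) len by (simp add: nth_append perm_sum_def order_isomorphic_def)
    next
      case 2
      then show ?thesis using cross cross' ij by blast
    next
      case 3
      then show ?thesis using cross[of j i] cross'[of j i] ij by auto
    next
      case 4
      then show ?thesis using vs(2) len ij by (simp add: nth_append perm_sum_def order_isomorphic_def)
    qed
  qed
  ultimately show ?thesis unfolding contains_def by blast
qed

text \<open>The part of an occurrence lying in \<open>\<alpha>\<close> is entirely below the part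
  lying in the shifted \<open>\<beta>\<close>, so the pattern itself is cut there by
  \<open>permutation_cut\<close>. Either piece may be empty.\<close>

lemma contains_perm_sumD:
  assumes perm: "permutation \<alpha>" "permutation \<beta>" "permutation \<pi>"
    and cont: "contains (\<alpha> \<oplus> \<beta>) \<pi>"
  obtains \<pi>1 \<pi>2 where "permutation \<pi>1" "permutation \<pi>2" "\<pi> = \<pi>1 \<oplus> \<pi>2"
    "contains \<alpha> \<pi>1" "contains \<beta> \<pi>2"
proof -
  obtain \<rho> where \<rho>: "subseq \<rho> (\<alpha> \<oplus> \<beta>)" "order_isomorphic \<rho> \<pi>"
    using cont by (auto simp: contains_def)
  obtain us vs' where us: "\<rho> = us @ vs'" "subseq us \<alpha>" and "subseq vs' (map (\<lambda>x. x + length \<alpha>) \<beta>)"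
    using \<rho>(1) unfolding perm_sum_def by (auto elim: subseq_appendE)
  then obtain vs where vs: "vs' = map (\<lambda>x. x + length \<alpha>) vs" "subseq vs \<beta>"
    by (metis nths_map subseq_conv_nths)
  let ?k = "length us"
  have len: "length \<pi> = length us + length vs"
    using \<rho>(2) us vs by (simp add: order_isomorphic_def)
  have less: "\<pi> ! i < \<pi> ! j" if "i < ?k" "?k \<le> j" "j < length \<pi>" for i j
  proof -
    have "us ! i \<in> set \<alpha>"
      using that by (intro subseq_set_subset[THEN subsetD, OF us(2)] nth_mem) auto
    then have "us ! i \<le> length \<alpha>" using perm by (simp add: permutation_iff)
    moreover have "vs ! (j - length us) \<in> set \<beta>"
      using that len by (intro subseq_set_subset[THEN subsetD, OF vs(2)] nth_mem) auto
    then have "0 < vs ! (j - length us)" using perm by (simp add: permutation_iff)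
    ultimately have "\<rho> ! i < \<rho> ! j" using that len us vs by (simp add: nth_append)
    then show ?thesis
      using order_isomorphic_nth[OF \<rho>(2), of i j] that len us vs by simp
  qed
  note cut = permutation_cut[OF perm(3) _ less]
  have "contains \<alpha> (take ?k \<pi>)"
    unfolding contains_def
  proof (intro exI conjI)
    show "order_isomorphic us (take ?k \<pi>)"
      unfolding order_isomorphic_def
    proof (intro conjI allI impI)
      show "length us = length (take ?k \<pi>)" using len by simp
      fix i j assume "i < length us" "j < length us"
      then show "us ! i < us ! j \<longleftrightarrow> take ?k \<pi> ! i < take ?k \<pi> ! j"
        using order_isomorphic_nth[OF \<rho>(2), of i j] us by (simp add: nth_append)
    qed
  qed (rule us(2))
  moreover have "contains \<beta> (map (\<lambda>x. x - ?k) (drop ?k \<pi>))" (is "contains _ ?\<pi>2")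
    unfolding contains_def
  proof (intro exI conjI)
    have \<pi>: "\<pi> ! (?k + i) = ?\<pi>2 ! i + ?k" if "i < length vs" for i
    proof -
      have "\<pi> ! (?k + i) = (take ?k \<pi> \<oplus> ?\<pi>2) ! (?k + i)"
        by (rule arg_cong[where f = "\<lambda>l. l ! (?k + i)"], rule cut(3)) (use len in auto)
      then show ?thesis using that len by (simp add: perm_sum_def nth_append)
    qed
    show "order_isomorphic vs ?\<pi>2"
      unfolding order_isomorphic_def
    proof (intro conjI allI impI)
      show "length vs = length ?\<pi>2" using len by simp
      fix i j assume ij: "i < length vs" "j < length vs"
      then show "vs ! i < vs ! j \<longleftrightarrow> ?\<pi>2 ! i < ?\<pi>2 ! j"
        using order_isomorphic_nth[OF \<rho>(2), of "?k + i" "?k + j"] us vs \<pi>[of i] \<pi>[of j]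
        by (simp add: nth_append)
    qed
  qed (rule vs(2))
  ultimately show ?thesis
    by (intro that[OF cut]) (simp_all add: len)
qed

text \<open>Unique decomposition forces the cut of the pattern to fall between two letters of
  \<open>s\<close>. Containment of sums thereby becomes a recursion on words, the one that defines
  \<open>hosts\<close> below.\<close>

lemma contains_perm_sums_Cons_iff:
  assumes t: "sum_indecomposable t" and w: "w \<in> lists {\<pi>. sum_indecomposable \<pi>}"
    and s: "s \<in> lists {\<pi>. sum_indecomposable \<pi>}"
  shows "contains (perm_sums (t # w)) (perm_sums s) \<longleftrightarrow>
    (\<exists>u v. s = u @ v \<and> contains t (perm_sums u) \<and> contains (perm_sums w) (perm_sums v))"
    (is "?L \<longleftrightarrow> ?R")
proof
  have perm: "permutation t" "permutation (perm_sums w)" "permutation (perm_sums s)"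
    using t w s by (auto simp: sum_indecomposable_def intro: lists_indecomposable_permutation)
  {
    assume ?L
    then obtain \<pi>1 \<pi>2 where \<pi>: "permutation \<pi>1" "permutation \<pi>2" "perm_sums s = \<pi>1 \<oplus> \<pi>2"
      "contains t \<pi>1" "contains (perm_sums w) \<pi>2"
      using contains_perm_sumD[OF perm] by auto
    obtain u where u: "u \<in> lists {\<pi>. sum_indecomposable \<pi>}" "\<pi>1 = perm_sums u"
      using \<pi>(1) by (rule permutation_decompose)
    obtain v where v: "v \<in> lists {\<pi>. sum_indecomposable \<pi>}" "\<pi>2 = perm_sums v"
      using \<pi>(2) by (rule permutation_decompose)
    have "s = u @ v"
      using \<pi>(3) u v s by (intro inj_onD[OF inj_on_perm_sums]) auto
    then show ?R using \<pi> u v by blast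
  }
  assume ?R
  then obtain u v where "s = u @ v" "contains t (perm_sums u)" "contains (perm_sums w) (perm_sums v)"
    by blast
  then show ?L
    using perm s by (auto intro!: contains_perm_sumI lists_indecomposable_permutation)
qed

text \<open>Without a 21 the first entry is smaller than all others, so it splits off as a summand
  unless it is alone.\<close>

lemma sum_indecomposable_avoiding_21:
  assumes ind: "sum_indecomposable \<pi>" and av: "\<not> contains \<pi> [2, 1]"
  shows "\<pi> = [1]"
proof -
  have perm: "permutation \<pi>" and ne: "\<pi> \<noteq> []"
    using ind unfolding sum_indecomposable_def by blast+
  have less: "\<pi> ! i < \<pi> ! j" if "i < 1" "1 \<le> j" "j < length \<pi>" for i j
  proof (rule ccontr)
    assume "\<not> \<pi> ! i < \<pi> ! j"
    moreover have "\<pi> ! i \<noteq> \<pi> ! j"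
      using perm that ne by (simp add: permutation_iff nth_eq_iff_index_eq)
    ultimately have gt: "\<pi> ! j < \<pi> ! i" by simp
    obtain x xs where \<pi>: "\<pi> = x # xs" using ne by (cases \<pi>) auto
    have "subseq [x, \<pi> ! j] \<pi>"
      using that unfolding \<pi> by (simp add: subseq_singleton_left nth_Cons')
    moreover have "order_isomorphic [x, \<pi> ! j] [2, 1]"
      using gt that \<pi> by (auto simp: order_isomorphic_def less_Suc_eq)
    ultimately show False using av by (auto simp: contains_def)
  qed
  have le: "1 \<le> length \<pi>" using ne by (cases \<pi>) auto
  note cut = permutation_cut[OF perm le less]
  have "length \<pi> = 1"
  proof (rule ccontr)
    assume "length \<pi> \<noteq> 1"
    then have "take 1 \<pi> \<noteq> []" "map (\<lambda>x. x - 1) (drop 1 \<pi>) \<noteq> []" using le ne by auto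
    with cut show False using ind unfolding sum_indecomposable_def by blast
  qed
  then show ?thesis using perm by (auto simp: permutation_iff length_Suc_conv)
qed

lemma sum_indecomposable_1: "sum_indecomposable [1]"
proof -
  have False if "\<alpha> \<noteq> []" "\<beta> \<noteq> []" "[1] = \<alpha> \<oplus> \<beta>" for \<alpha> \<beta>
  proof -
    have "length \<alpha> + length \<beta> = 1" using arg_cong[OF that(3), of length] by simp
    then show False using that(1,2) by (auto simp: add_is_1)
  qed
  moreover have "permutation [1]" by (simp add: permutation_iff)
  ultimately show ?thesis unfolding sum_indecomposable_def by blast
qed

lemma sum_indecomposable_21: "sum_indecomposable [2, 1]"
proof -
  have False if "permutation \<alpha>" "permutation \<beta>" "\<alpha> \<noteq> []" "\<beta> \<noteq> []" "[2, 1] = \<alpha> \<oplus> \<beta>" for \<alpha> \<beta>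
  proof -
    have len: "length \<alpha> + length \<beta> = 2" using arg_cong[OF that(5), of length] by simp
    moreover have "0 < length \<alpha>" "0 < length \<beta>" using that(3,4) by simp_all
    ultimately have "length \<alpha> = 1" by linarith
    then show False using perm_sum_nth_less[OF that(1,2), of 0 1] len
      by (simp flip: that(5))
  qed
  moreover have "{1..2} = {2, 1::nat}" by auto
  then have "permutation [2, 1]" by (simp add: permutation_iff eval_nat_numeral)
  ultimately show ?thesis unfolding sum_indecomposable_def by blast
qed

section \<open>Words over a weighted alphabet\<close>

text \<open>In the application the letters are the sum-indecomposables of a class, weighted by size.
  The two assumptions ensure that there are finitely many words of each weight.\<close>

locale weighted_alphabet =
  fixes A :: "'a set" and wt :: "'a \<Rightarrow> nat"
  assumes wt_pos: "a \<in> A \<Longrightarrow> 0 < wt a"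
    and finite_letters: "finite {a \<in> A. wt a = n}"
begin

definition weight :: "'a list \<Rightarrow> nat" where
  "weight w = sum_list (map wt w)"

lemma weight_simps [simp]:
  "weight [] = 0" "weight (a # w) = wt a + weight w" "weight (v @ w) = weight v + weight w"
  by (simp_all add: weight_def)

definition words :: "nat \<Rightarrow> 'a list set" where
  "words n = {w \<in> lists A. weight w = n}"

lemma finite_letters_le: "finite {a \<in> A. wt a \<le> n}"
proof -
  have "{a \<in> A. wt a \<le> n} = (\<Union>k\<le>n. {a \<in> A. wt a = k})" by auto
  then show ?thesis using finite_letters by simp
qed

lemma length_le_weight: "w \<in> lists A \<Longrightarrow> length w \<le> weight w"
proof (induction w)
  case (Cons a w)
  then show ?case using wt_pos[of a] by auto
qed simp

lemma wt_le_weight: "a \<in> set w \<Longrightarrow> wt a \<le> weight w"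
  unfolding weight_def by (intro member_le_sum_list) auto

lemma words_subset: "words n \<subseteq> {w. set w \<subseteq> {a \<in> A. wt a \<le> n} \<and> length w \<le> n}"
  by (auto simp: words_def dest: wt_le_weight length_le_weight[OF iffD2[OF in_lists_conv_set]])

lemma finite_words [simp]: "finite (words n)"
  by (rule finite_subset[OF words_subset finite_lists_length_le[OF finite_letters_le]])

text \<open>Grouping letters by weight links sums over finite sets of letters to truncations of the
  generating function.\<close>

lemma sum_letters_le:
  fixes x :: real
  shows "(\<Sum>a | a \<in> A \<and> wt a \<le> n. x ^ wt a) = (\<Sum>k\<le>n. real (card {a \<in> A. wt a = k}) * x ^ k)"
proof -
  have "(\<Sum>k\<le>n. real (card {a \<in> A. wt a = k}) * x ^ k)
      = (\<Sum>k\<le>n. \<Sum>a | a \<in> {a \<in> A. wt a \<le> n} \<and> wt a = k. x ^ wt a)"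
  proof (rule sum.cong)
    fix k assume "k \<in> {..n}"
    then have "{a. a \<in> {a \<in> A. wt a \<le> n} \<and> wt a = k} = {a \<in> A. wt a = k}" by auto
    then show "real (card {a \<in> A. wt a = k}) * x ^ k
      = (\<Sum>a | a \<in> {a \<in> A. wt a \<le> n} \<and> wt a = k. x ^ wt a)" by simp
  qed simp
  also have "\<dots> = (\<Sum>a | a \<in> A \<and> wt a \<le> n. x ^ wt a)"
    by (rule sum.group) (auto simp: finite_letters_le)
  finally show ?thesis by simp
qed

section \<open>Generating functions of sets of words\<close>

definition word_fps :: "'a list set \<Rightarrow> real fps" where
  "word_fps S = Abs_fps (\<lambda>n. real (card (S \<inter> words n)))"

text \<open>Unambiguous concatenation gives the Cauchy product: the words of weight \<open>n\<close>
  are sorted by the weight \<open>k\<close> of their left factor.\<close>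

lemma word_fps_append:
  assumes UV: "U \<subseteq> lists A" "V \<subseteq> lists A"
    and inj: "inj_on (\<lambda>(u, v). u @ v) (U \<times> V)"
  shows "word_fps ((\<lambda>(u, v). u @ v) ` (U \<times> V)) = word_fps U * word_fps V"
proof (rule fps_ext)
  fix n
  have disj: "words k \<inter> words l = {}" if "k \<noteq> l" for k l
    using that by (auto simp: words_def)
  let ?P = "\<lambda>k. (U \<inter> words k) \<times> (V \<inter> words (n - k))"
  have "(\<lambda>(u, v). u @ v) ` (U \<times> V) \<inter> words n = (\<lambda>(u, v). u @ v) ` (\<Union>k\<in>{0..n}. ?P k)"
    using UV by (force simp: words_def image_iff)
  moreover have "inj_on (\<lambda>(u, v). u @ v) (\<Union>k\<in>{0..n}. ?P k)"
    by (rule inj_on_subset[OF inj]) auto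
  moreover have "card (\<Union>k\<in>{0..n}. ?P k) = (\<Sum>k\<in>{0..n}. card (?P k))"
    by (rule card_UN_disjoint) (use disj in auto)
  ultimately show "fps_nth (word_fps ((\<lambda>(u, v). u @ v) ` (U \<times> V))) n = fps_nth (word_fps U * word_fps V) n"
    by (simp add: word_fps_def fps_mult_nth card_image card_cartesian_product)
qed

section \<open>Lower and upper bounds for the number of words\<close>

lemma sum_words_length:
  fixes x :: real
  assumes "finite F"
  shows "(\<Sum>w | set w \<subseteq> F \<and> length w = k. x ^ weight w) = (\<Sum>a\<in>F. x ^ wt a) ^ k"
proof (induction k)
  case 0
  have "{w. set w \<subseteq> F \<and> length w = 0} = {[]}" by auto
  then show ?case by simp
next
  case (Suc k)
  let ?W = "{w. set w \<subseteq> F \<and> length w = k}"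
  have "(\<Sum>w | set w \<subseteq> F \<and> length w = Suc k. x ^ weight w)
      = (\<Sum>(w, a)\<in>?W \<times> F. x ^ weight w * x ^ wt a)"
    unfolding lists_length_Suc_eq
    by (subst sum.reindex) (auto simp: inj_on_def case_prod_unfold power_add ac_simps)
  also have "\<dots> = (\<Sum>w\<in>?W. x ^ weight w) * (\<Sum>a\<in>F. x ^ wt a)"
    by (simp add: sum_product sum.cartesian_product)
  finally show ?case using Suc by (simp add: mult.commute)
qed

text \<open>Prefixing letters of \<open>F\<close> bounds the number of words of weight
  \<open>n\<close> below by the sum of those of weight \<open>n - wt a\<close>. After multiplication
  by \<open>y ^ n\<close>, the condition on \<open>F\<close> preserves the bound
  \<open>\<delta>\<close> along the induction.\<close>

lemma words_lower_bound:
  fixes y :: real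
  assumes y: "0 < y" and one: "\<And>n. words n \<noteq> {}"
    and F: "finite F" "F \<subseteq> A" "1 \<le> (\<Sum>a\<in>F. y ^ wt a)"
  obtains \<delta> where "0 < \<delta>" "\<And>n. \<delta> \<le> real (card (words n)) * y ^ n"
proof -
  define N where "N = Max (wt ` F)"
  have N: "wt a \<le> N" if "a \<in> F" for a
    using that F(1) by (simp add: N_def)
  \<comment> \<open>This is a lower bound for \<open>y ^ n\<close> for all \<open>n \<le> N\<close>,
    whether \<open>y\<close> is below or above 1. For \<open>n > N\<close> every difference
    \<open>n - wt a\<close> with \<open>a\<close> in \<open>F\<close> is positive.\<close>
  define \<delta> where "\<delta> = min 1 (y ^ N)"
  have "\<delta> \<le> real (card (words n)) * y ^ n" for n
  proof (induction n rule: less_induct)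
    case (less n)
    show ?case
    proof (cases "n \<le> N")
      case True
      have "\<delta> \<le> y ^ n"
      proof (cases "y \<le> 1")
        case yle: True
        then have "y ^ N \<le> y ^ n" using y True by (intro power_decreasing) auto
        then show ?thesis by (simp add: \<delta>_def)
      next
        case False
        then show ?thesis using one_le_power[of y n] by (simp add: \<delta>_def min_le_iff_disj)
      qed
      moreover have "1 \<le> real (card (words n))"
        using one[of n] by (simp add: Suc_le_eq card_gt_0_iff)
      then have "y ^ n \<le> real (card (words n)) * y ^ n" using y by simp
      ultimately show ?thesis by linarith
    next
      case False
      have sub: "(\<Union>a\<in>F. (#) a ` words (n - wt a)) \<subseteq> words n"
      proof
        fix w assume "w \<in> (\<Union>a\<in>F. (#) a ` words (n - wt a))"
        then obtain a v where "a \<in> F" "w = a # v" "v \<in> words (n - wt a)" by auto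
        then show "w \<in> words n" using F(2) N[of a] False by (auto simp: words_def)
      qed
      have "(\<Sum>a\<in>F. card (words (n - wt a))) = card (\<Union>a\<in>F. (#) a ` words (n - wt a))"
        using F(1) by (subst card_UN_disjoint) (auto simp: card_image)
      also have "\<dots> \<le> card (words n)" by (rule card_mono[OF finite_words sub])
      finally have rec: "(\<Sum>a\<in>F. real (card (words (n - wt a)))) \<le> real (card (words n))"
        by (metis of_nat_mono of_nat_sum)
      have "\<delta> \<le> \<delta> * (\<Sum>a\<in>F. y ^ wt a)"
        using F(3) y by (simp add: \<delta>_def)
      also have "\<dots> = (\<Sum>a\<in>F. \<delta> * y ^ wt a)" by (rule sum_distrib_left)
      also have "\<dots> \<le> (\<Sum>a\<in>F. real (card (words (n - wt a))) * y ^ n)"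
      proof (rule sum_mono)
        fix a assume a: "a \<in> F"
        then have n: "n - wt a < n" "n = (n - wt a) + wt a"
          using wt_pos[of a] F(2) N[of a] False by auto
        have "\<delta> * y ^ wt a \<le> (real (card (words (n - wt a))) * y ^ (n - wt a)) * y ^ wt a"
          using less.IH[OF n(1)] y by (intro mult_right_mono) auto
        also have "\<dots> = real (card (words (n - wt a))) * y ^ n"
          using n(2) by (metis mult.assoc power_add)
        finally show "\<delta> * y ^ wt a \<le> real (card (words (n - wt a))) * y ^ n" .
      qed
      also have "\<dots> \<le> real (card (words n)) * y ^ n"
        unfolding sum_distrib_right[symmetric] using rec y by (intro mult_right_mono) auto
      finally show ?thesis .
    qed
  qed
  moreover have "0 < \<delta>" using y by (simp add: \<delta>_def)
  ultimately show thesis using that by blast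
qed

text \<open>The first \<open>length W\<close> letters of a long enough word without the factor
  \<open>W\<close> form a chunk other than \<open>W\<close>, and the rest still avoids
  \<open>W\<close>. The weighted sums over such words of fixed length thus decay
  geometrically.\<close>

lemma words_avoiding_factor_upper_bound:
  fixes x q :: real
  assumes x: "0 < x" and W: "W \<in> lists A" "W \<noteq> []"
    and q: "\<And>F. finite F \<Longrightarrow> F \<subseteq> A \<Longrightarrow> (\<Sum>a\<in>F. x ^ wt a) \<le> q"
    and less: "q ^ length W - x ^ weight W < 1"
  obtains K where "\<And>n. real (card {w \<in> words n. \<not> sublist W w}) * x ^ n \<le> K"
proof -
  define L where "L = length W"
  \<comment> \<open>\<open>r\<close> bounds the weighted sum over the chunks of length
    \<open>L\<close> other than \<open>W\<close>; \<open>D\<close> bounds the total over all lengths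
    below \<open>L\<close>.\<close>
  define r where "r = max 0 (q ^ L - x ^ weight W)"
  define D where "D = (\<Sum>k<L. q ^ k)"
  have r: "0 \<le> r" "r < 1" using less by (auto simp: r_def L_def)
  have bound: "real (card {w \<in> words n. \<not> sublist W w}) * x ^ n \<le> D / (1 - r)" for n
  proof -
    \<comment> \<open>Letters of weight at most \<open>n\<close> suffice for words of weight
      \<open>n\<close>. The letters of \<open>W\<close> are added so that \<open>W\<close> is among
      the chunks and its weight can be subtracted.\<close>
    define F where "F = {a \<in> A. wt a \<le> n} \<union> set W"
    have F: "finite F" "F \<subseteq> A" "set W \<subseteq> F"
      using finite_letters_le W by (auto simp: F_def)
    define S where "S k = {w. set w \<subseteq> F \<and> length w = k \<and> \<not> sublist W w}" for k
    define T where "T k = (\<Sum>w\<in>S k. x ^ weight w)" for k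
    have finL: "finite {w. set w \<subseteq> F \<and> length w = k}" for k
      by (rule finite_lists_length_eq[OF F(1)])
    have finS: "finite (S k)" for k
      by (rule finite_subset[OF _ finL[of k]]) (auto simp: S_def)
    have T0: "0 \<le> T k" for k
      unfolding T_def using x by (intro sum_nonneg) auto
    have full: "(\<Sum>w | set w \<subseteq> F \<and> length w = k. x ^ weight w) \<le> q ^ k" for k
      unfolding sum_words_length[OF F(1)]
      using q[OF F(1,2)] x by (intro power_mono sum_nonneg) auto
    have Tq: "T k \<le> q ^ k" for k
    proof -
      have "T k \<le> (\<Sum>w | set w \<subseteq> F \<and> length w = k. x ^ weight w)"
        unfolding T_def using x by (intro sum_mono2 finL) (auto simp: S_def)
      with full[of k] show ?thesis by simp
    qed
    have step: "T (L + k) \<le> r * T k" for k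
    proof -
      let ?B = "{w. set w \<subseteq> F \<and> length w = L} - {W}"
      have inj: "inj_on (\<lambda>(u, v). u @ v) (?B \<times> S k)"
        by (auto simp: inj_on_def)
      have sub: "S (L + k) \<subseteq> (\<lambda>(u, v). u @ v) ` (?B \<times> S k)"
      proof
        fix w assume w: "w \<in> S (L + k)"
        have "take L w \<noteq> W"
        proof
          assume "take L w = W"
          then have "sublist W w" by (metis sublist_take)
          then show False using w by (simp add: S_def)
        qed
        moreover have "\<not> sublist W (drop L w)"
          using w by (auto simp: S_def intro: sublist_order.order.trans)
        ultimately have "(take L w, drop L w) \<in> ?B \<times> S k"
          using w by (auto simp: S_def dest: in_set_takeD in_set_dropD)
        then show "w \<in> (\<lambda>(u, v). u @ v) ` (?B \<times> S k)"
          by (rule rev_image_eqI) simp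
      qed
      have "T (L + k) \<le> (\<Sum>w\<in>(\<lambda>(u, v). u @ v) ` (?B \<times> S k). x ^ weight w)"
        unfolding T_def using finL finS x by (intro sum_mono2 sub finite_imageI finite_cartesian_product) auto
      also have "\<dots> = (\<Sum>(u, v)\<in>?B \<times> S k. x ^ weight u * x ^ weight v)"
        by (subst sum.reindex[OF inj]) (simp add: case_prod_unfold power_add)
      also have "\<dots> = (\<Sum>u\<in>?B. x ^ weight u) * T k"
        by (simp add: T_def sum_product sum.cartesian_product)
      also have "(\<Sum>u\<in>?B. x ^ weight u) \<le> r"
      proof -
        have "(\<Sum>u\<in>?B. x ^ weight u) = (\<Sum>w | set w \<subseteq> F \<and> length w = L. x ^ weight w) - x ^ weight W"
          using finL F(3) by (subst sum_diff1) (auto simp: L_def)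
        then show ?thesis using full[of L] by (simp add: r_def)
      qed
      finally show ?thesis using T0 by (simp add: mult_right_mono)
    qed
    \<comment> \<open>A word of weight \<open>n\<close> has at most \<open>n\<close> letters, so
      \<open>Z\<close> accounts for all of them. Separating the lengths below \<open>L\<close> gives
      \<open>Z \<le> D + r * Z\<close>, a bound that does not depend on \<open>n\<close>.\<close>
    define Z where "Z = (\<Sum>k<Suc n. T k)"
    have "Z \<le> (\<Sum>k<L + Suc n. T k)"
      unfolding Z_def using T0 by (intro sum_mono2) auto
    also have "\<dots> = (\<Sum>k<L. T k) + (\<Sum>k<Suc n. T (L + k))"
      by (induction n) (simp_all)
    also have "\<dots> \<le> D + r * Z"
      unfolding D_def Z_def sum_distrib_left by (intro add_mono sum_mono Tq step)
    finally have Z: "Z \<le> D / (1 - r)" using r by (simp add: field_simps)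
    have "real (card {w \<in> words n. \<not> sublist W w}) * x ^ n
        = (\<Sum>w | w \<in> words n \<and> \<not> sublist W w. x ^ weight w)"
      by (simp add: words_def)
    also have "\<dots> \<le> (\<Sum>w\<in>(\<Union>k<Suc n. S k). x ^ weight w)"
    proof (intro sum_mono2)
      show "{w \<in> words n. \<not> sublist W w} \<subseteq> (\<Union>k<Suc n. S k)"
        using words_subset[of n] by (fastforce simp: S_def F_def)
    qed (use x finS in auto)
    also have "\<dots> = Z"
      unfolding Z_def T_def using finS by (intro sum.UNION_disjoint) (auto simp: S_def)
    finally show ?thesis using Z by linarith
  qed
  then show thesis by (rule that)
qed

end

section \<open>Hosting words and their generating functions\<close>

locale word_embedding = weighted_alphabet A wt for A :: "'a set" and wt +
  fixes covers :: "'a \<Rightarrow> 'a list \<Rightarrow> bool"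
  assumes covers_Nil: "covers t []"
    and covers_factor: "covers t (u @ v @ w) \<Longrightarrow> covers t v"
begin

text \<open>With \<open>covers t u\<close> meaning that the letter \<open>t\<close> contains the sum
  of the word \<open>u\<close>, this is containment of the sum of the second word in the sum of the
  first.\<close>

primrec hosts :: "'a list \<Rightarrow> 'a list \<Rightarrow> bool" where
  "hosts [] s = (s = [])"
| "hosts (t # \<tau>) s = (\<exists>u v. s = u @ v \<and> covers t u \<and> hosts \<tau> v)"

lemma hosts_Nil [simp]: "hosts \<tau> []"
  by (induction \<tau>) (auto simp: covers_Nil)

lemma hosts_append: "hosts \<tau> s \<Longrightarrow> hosts \<tau>' s' \<Longrightarrow> hosts (\<tau> @ \<tau>') (s @ s')"
proof (induction \<tau> arbitrary: s)
  case (Cons t \<tau>)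
  then obtain u v where "s = u @ v" "covers t u" "hosts \<tau> v" by auto
  then have "s @ s' = u @ (v @ s')" "covers t u" "hosts (\<tau> @ \<tau>') (v @ s')"
    using Cons.IH[of v] Cons.prems(2) by auto
  then show ?case unfolding append_Cons hosts.simps by blast
qed simp

definition hosting :: "'a list \<Rightarrow> 'a list set" where
  "hosting s = {\<tau> \<in> lists A. hosts \<tau> s}"

lemma hosting_Nil: "hosting [] = lists A"
  by (simp add: hosting_def)

text \<open>Minimality refers to prefixes. Such words form a prefix code, which makes the
  factorization of a host unique.\<close>

definition minimal_hosting :: "'a list \<Rightarrow> 'a list set" where
  "minimal_hosting s = {\<tau> \<in> hosting s. \<forall>u v. \<tau> = u @ v \<longrightarrow> hosts u s \<longrightarrow> v = []}"

lemma minimal_hosting_prefix: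
  assumes "\<tau> \<in> hosting s"
  obtains u v where "\<tau> = u @ v" "u \<in> minimal_hosting s" "v \<in> lists A"
  using assms
proof (induction \<tau> arbitrary: thesis rule: length_induct)
  case (1 \<tau>)
  show ?case
  proof (cases "\<tau> \<in> minimal_hosting s")
    case True
    then show ?thesis using "1.prems"(1)[of \<tau> "[]"] by simp
  next
    case False
    then obtain u v where uv: "\<tau> = u @ v" "hosts u s" "v \<noteq> []"
      using "1.prems"(2) by (auto simp: minimal_hosting_def)
    then have "u \<in> hosting s" "length u < length \<tau>" "v \<in> lists A"
      using "1.prems"(2) by (auto simp: hosting_def)
    with "1.IH" obtain u' v' where "u = u' @ v'" "u' \<in> minimal_hosting s" "v' \<in> lists A" by metis
    then show ?thesis using "1.prems"(1)[of u' "v' @ v"] uv \<open>v \<in> lists A\<close> by simp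
  qed
qed

text \<open>No letter of the host has to be shared between \<open>s\<close> and
  \<open>s'\<close>.\<close>

definition splits :: "'a list \<Rightarrow> 'a list \<Rightarrow> bool" where
  "splits s s' \<longleftrightarrow> (\<forall>\<tau>\<in>lists A. hosts \<tau> (s @ s') \<longrightarrow>
     (\<exists>u v. \<tau> = u @ v \<and> hosts u s \<and> hosts v s'))"

text \<open>Reduce the part hosting \<open>s\<close> to a minimal prefix and hand the surplus to the
  part hosting \<open>s'\<close>. The prefix code property makes this factorization unique.\<close>

lemma word_fps_hosting_minimal:
  assumes "splits s s'"
  shows "word_fps (hosting (s @ s')) = word_fps (minimal_hosting s) * word_fps (hosting s')"
proof -
  have "hosting (s @ s') = (\<lambda>(u, v). u @ v) ` (minimal_hosting s \<times> hosting s')"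
  proof (intro equalityI subsetI)
    fix \<tau> assume \<tau>: "\<tau> \<in> hosting (s @ s')"
    then obtain u v where uv: "\<tau> = u @ v" "hosts u s" "hosts v s'"
      using assms by (auto simp: splits_def hosting_def)
    then have "u \<in> hosting s" "v \<in> lists A" using \<tau> by (auto simp: hosting_def)
    then obtain u1 u2 where u: "u = u1 @ u2" "u1 \<in> minimal_hosting s" "u2 \<in> lists A"
      by (elim minimal_hosting_prefix)
    have "hosts (u2 @ v) s'" using hosts_append[of u2 "[]" v s'] uv by simp
    then have "(u1, u2 @ v) \<in> minimal_hosting s \<times> hosting s'"
      using u \<open>v \<in> lists A\<close> by (simp add: hosting_def)
    then show "\<tau> \<in> (\<lambda>(u, v). u @ v) ` (minimal_hosting s \<times> hosting s')"
      by (rule rev_image_eqI) (simp add: uv u)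
  next
    fix \<tau> assume "\<tau> \<in> (\<lambda>(u, v). u @ v) ` (minimal_hosting s \<times> hosting s')"
    then show "\<tau> \<in> hosting (s @ s')"
      by (auto simp: minimal_hosting_def hosting_def intro: hosts_append)
  qed
  moreover have "inj_on (\<lambda>(u, v). u @ v) (minimal_hosting s \<times> hosting s')"
    by (auto simp: inj_on_def minimal_hosting_def hosting_def append_eq_append_conv2)
  ultimately show ?thesis
    by (simp add: word_fps_append minimal_hosting_def hosting_def subset_iff)
qed

text \<open>The case of an empty second word expresses the series of \<open>hosting s\<close>
  through that of \<open>minimal_hosting s\<close>; combining both identities eliminates the
  latter.\<close>

lemma word_fps_hosting_append:
  assumes "splits s s'"
  shows "word_fps (lists A) * word_fps (hosting (s @ s')) = word_fps (hosting s) * word_fps (hosting s')"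
proof -
  have "splits s []" by (auto simp: splits_def)
  from word_fps_hosting_minimal[OF this]
  have "word_fps (hosting s) = word_fps (minimal_hosting s) * word_fps (lists A)"
    by (simp add: hosting_Nil)
  with word_fps_hosting_minimal[OF assms] show ?thesis by (simp add: ac_simps)
qed

lemma word_fps_lists_nonzero: "word_fps (lists A) \<noteq> 0"
proof -
  have "[] \<in> words 0" by (simp add: words_def)
  then have "lists A \<inter> words 0 \<noteq> {}" by blast
  then have "fps_nth (word_fps (lists A)) 0 \<noteq> 0" by (simp add: word_fps_def)
  then show ?thesis by auto
qed

text \<open>A host letter straddling the boundary between \<open>a\<close> and \<open>b\<close>
  would cover the factor \<open>[a, b]\<close>. The induction on the host looks for the letter
  boundary that meets this place.\<close>

lemma splits_incompatible:
  assumes ab: "\<And>t. t \<in> A \<Longrightarrow> \<not> covers t [a, b]"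
  shows "splits (s @ [a]) (b # s')"
proof -
  have "\<exists>u v. \<tau> = u @ v \<and> hosts u (s @ [a]) \<and> hosts v (b # s')"
    if "\<tau> \<in> lists A" "hosts \<tau> (s @ a # b # s')" for \<tau> s
    using that
  proof (induction \<tau> arbitrary: s)
    case Nil
    then show ?case by simp
  next
    case (Cons t \<tau>)
    then obtain p r where pr: "s @ a # b # s' = p @ r" "covers t p" "hosts \<tau> r" by auto
    from pr(1) have "(s @ [a]) @ (b # s') = p @ r" by simp
    then obtain m where "s @ [a] = p @ m \<and> m @ b # s' = r \<or> (s @ [a]) @ m = p \<and> b # s' = m @ r"
      unfolding append_eq_append_conv2 by blast
    \<comment> \<open>The factor \<open>p\<close> taken by \<open>t\<close> ends beyond, exactly at,
      or before the boundary between \<open>a\<close> and \<open>b\<close>.\<close>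
    then consider (long) m where "p = (s @ [a]) @ m" "m \<noteq> []" "b # s' = m @ r"
      | (exact) "p = s @ [a]" "r = b # s'"
      | (short) m where "s @ [a] = p @ m" "m \<noteq> []" "r = m @ b # s'"
      by (cases "m = []") auto
    then show ?case
    proof cases
      case long
      then obtain m' where "m = b # m'" by (cases m) auto
      then have "p = s @ [a, b] @ m'" using long(1) by simp
      then have "covers t [a, b]" using pr(2) covers_factor by metis
      moreover have "t \<in> A" using Cons.hyps by simp
      ultimately show ?thesis using ab by blast
    next
      case exact
      then have "hosts [t] (s @ [a])" using pr(2) by auto
      then show ?thesis using exact pr(3) by (metis append_Cons append_Nil)
    next
      case short
      then obtain m' where m': "m = m' @ [a]" by (metis append_butlast_last_id last_appendR last_snoc)
      then obtain u v where "\<tau> = u @ v" "hosts u (m' @ [a])" "hosts v (b # s')"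
        using Cons.IH[of m'] short pr(3) by auto
      then have "t # \<tau> = (t # u) @ v" "hosts (t # u) (s @ [a])" "hosts v (b # s')"
        using short m' pr(2) by auto
      then show ?thesis by blast
    qed
  qed
  then show ?thesis by (simp add: splits_def)
qed

text \<open>Cutting at the three displayed places where \<open>a\<close> meets \<open>b\<close>
  gives, up to the third power of the series of all words, a product of four series symmetric in
  \<open>u\<close> and \<open>v\<close>. The power is nonzero and cancels.\<close>

lemma word_fps_hosting_swap:
  assumes ab: "\<And>t. t \<in> A \<Longrightarrow> \<not> covers t [a, b]"
  shows "word_fps (hosting (p @ [a] @ (b # u @ [a]) @ (b # v @ [a]) @ b # s))
    = word_fps (hosting (p @ [a] @ (b # v @ [a]) @ (b # u @ [a]) @ b # s))"
proof -
  let ?c = "word_fps (lists A)" and ?h = "\<lambda>w. word_fps (hosting w)"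
  have split: "?c * ?h (w @ [a] @ b # w') = ?h (w @ [a]) * ?h (b # w')" for w w'
    using word_fps_hosting_append[OF splits_incompatible[OF ab]] by simp
  have expand: "?c * (?c * (?c * ?h (p @ [a] @ (b # u @ [a]) @ (b # v @ [a]) @ b # s)))
    = ?h (p @ [a]) * ?h (b # u @ [a]) * ?h (b # v @ [a]) * ?h (b # s)" for u v
    using split[of p "u @ [a] @ b # v @ [a] @ b # s"] split[of "b # u" "v @ [a] @ b # s"]
      split[of "b # v" s]
    by (simp add: ac_simps)
  have "?c * (?c * (?c * ?h (p @ [a] @ (b # u @ [a]) @ (b # v @ [a]) @ b # s)))
    = ?c * (?c * (?c * ?h (p @ [a] @ (b # v @ [a]) @ (b # u @ [a]) @ b # s)))"
    unfolding expand by (simp add: ac_simps)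
  then show ?thesis using word_fps_lists_nonzero by simp
qed

end

text \<open>The sum of the zero-based positions of \<open>a\<close>: every occurrence is counted
  once for each letter before it.\<close>

primrec position_sum :: "'a \<Rightarrow> 'a list \<Rightarrow> nat" where
  "position_sum a [] = 0"
| "position_sum a (c # w) = position_sum a w + count_list w a"

lemma position_sum_append:
  "position_sum a (v @ w) = position_sum a v + position_sum a w + length v * count_list w a"
  by (induction v) (simp_all add: algebra_simps)

text \<open>The factor \<open>x a b\<close> becomes \<open>a b x\<close>: the letter
  \<open>x\<close>, which is not \<open>a\<close>, moves right past an \<open>a\<close>. The
  argument also covers \<open>b = a\<close> and \<open>b = x\<close>.\<close>

lemma position_sum_swap:
  "x \<noteq> a \<Longrightarrow> position_sum a (p @ [a, b, a, b, x, a, b] @ s)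
    < position_sum a (p @ [a, b, x, a, b, a, b] @ s)"
  by (simp add: position_sum_append)

section \<open>Power series around the point where the value is 1\<close>

text \<open>All terms are monotone, and the linear term strictly so.\<close>

lemma eval_fps_strict_mono:
  fixes f :: "real fps"
  assumes nonneg: "\<And>n. 0 \<le> fps_nth f n" and pos: "0 < fps_nth f 1"
    and x: "0 \<le> x" "x < y" "ereal y < fps_conv_radius f"
  shows "eval_fps f x < eval_fps f y"
proof -
  have "ereal x < fps_conv_radius f" using x by (meson ereal_less_le less_eq_real_def less_ereal.simps(1) less_trans)
  then have "(\<lambda>n. fps_nth f n * x ^ n) sums eval_fps f x" "(\<lambda>n. fps_nth f n * y ^ n) sums eval_fps f y"
    using x by (auto intro!: sums_eval_fps)
  then have s: "(\<lambda>n. fps_nth f n * y ^ n - fps_nth f n * x ^ n) sums (eval_fps f y - eval_fps f x)"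
    by (rule sums_diff[rotated])
  have "0 < (\<Sum>n. fps_nth f n * y ^ n - fps_nth f n * x ^ n)"
  proof (rule suminf_pos2[OF sums_summable[OF s], of 1])
    show "0 \<le> fps_nth f n * y ^ n - fps_nth f n * x ^ n" for n
      using nonneg[of n] x by (simp add: mult_left_mono power_mono)
    show "0 < fps_nth f 1 * y ^ 1 - fps_nth f 1 * x ^ 1" using pos x by simp
  qed
  with s show ?thesis by (simp add: sums_iff)
qed

text \<open>At the point \<open>x0\<close> where the value is 1, the expression to be bounded is
  \<open>1 - x0 ^ s\<close>, which is below 1. By continuity it stays below 1 at some
  \<open>x\<close> to the right of \<open>x0\<close>, and any \<open>y\<close> between them has
  value above 1.\<close>

lemma supercritical_window:
  fixes f :: "real fps"
  assumes nonneg: "\<And>n. 0 \<le> fps_nth f n" and f0: "fps_nth f 0 = 0" and f1: "0 < fps_nth f 1"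
    and X: "0 < X" "ereal X < fps_conv_radius f" "1 < eval_fps f X"
  obtains x y where "0 < y" "y < x" "ereal x < fps_conv_radius f" "1 < eval_fps f y"
    "eval_fps f x ^ L - x ^ s < 1"
proof -
  have rad: "ereal t < fps_conv_radius f" if "t \<le> X" for t
    using that X(2) by (meson ereal_less_eq(3) le_less_trans)
  have cont: "continuous_on {0..X} (eval_fps f)"
    by (rule continuous_on_eval_fps') (auto simp: in_eball_iff intro: rad)
  have "eval_fps f 0 = 0" by (simp add: eval_fps_at_0 f0)
  then obtain x0 where x0: "0 \<le> x0" "x0 \<le> X" "eval_fps f x0 = 1"
    using IVT'[of "eval_fps f" 0 1 X] X cont by auto
  have "x0 \<noteq> 0" "x0 \<noteq> X" using x0 X \<open>eval_fps f 0 = 0\<close> by auto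
  then have x0': "0 < x0" "x0 < X" using x0 by auto
  let ?g = "\<lambda>x. eval_fps f x ^ L - x ^ s"
  have "continuous_on {0..X} ?g"
    by (intro continuous_intros cont)
  moreover have "?g x0 < 1" using x0 x0' by simp
  ultimately have "\<forall>\<^sub>F x in at x0 within {0..X}. ?g x < 1"
    using x0(1,2) by (intro order_tendstoD(2)[of ?g "?g x0"]) (auto simp: continuous_on_def)
  then obtain d where d: "0 < d" "\<And>x. x \<in> {0..X} \<Longrightarrow> x \<noteq> x0 \<Longrightarrow> dist x x0 < d \<Longrightarrow> ?g x < 1"
    unfolding eventually_at by auto
  \<comment> \<open>Halving keeps \<open>x\<close> strictly below \<open>X\<close> and strictly
    within distance \<open>d\<close> of \<open>x0\<close>.\<close>
  define x where "x = x0 + min d (X - x0) / 2"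
  define y where "y = (x0 + x) / 2"
  have xy: "x0 < y" "y < x" "x < X" "x - x0 < d"
    using d(1) x0' by (auto simp: x_def y_def min_def field_simps)
  have "?g x < 1" using xy x0' by (intro d(2)) (auto simp: dist_real_def)
  moreover have "eval_fps f x0 < eval_fps f y"
    using xy x0' by (intro eval_fps_strict_mono nonneg f1 rad) auto
  ultimately show thesis using that[of y x] xy x0' x0(3) rad[of x] by auto
qed

text \<open>A limit above 1 forces a value above 1 at a positive real point inside the disc of
  convergence, also when the radius or the limit is infinite.\<close>

lemma supercriticalD:
  assumes "supercritical C"
  obtains X where "0 < X" "ereal X < fps_conv_radius (gen_fun (indecomposables C))"
    "1 < eval_fps (gen_fun (indecomposables C)) X"
proof -
  let ?A = "gen_fun (indecomposables C)"
  let ?\<rho> = "fps_conv_radius ?A"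
  obtain L where pos: "0 < ?\<rho>" and L: "1 < L"
    and lim: "((\<lambda>x::ereal. ereal (eval_fps ?A (real_of_ereal x))) \<longlongrightarrow> L) (at_left ?\<rho>)"
    using assms by (auto simp: supercritical_def Let_def)
  from order_tendstoD(1)[OF lim L]
  obtain b where b: "b < ?\<rho>" "\<And>x. b < x \<Longrightarrow> x < ?\<rho> \<Longrightarrow> 1 < ereal (eval_fps ?A (real_of_ereal x))"
    using eventually_at_left[OF pos] by auto
  have "max 0 b < ?\<rho>" using b(1) pos by simp
  then obtain X where X: "max 0 b < ereal X" "ereal X < ?\<rho>"
    using ereal_dense2 by blast
  then show thesis using that[of X] b(2)[of "ereal X"] by (auto simp: one_ereal_def zero_ereal_def)
qed

lemma sum_le_eval_fps:
  fixes f :: "real fps"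
  assumes "\<And>n. 0 \<le> fps_nth f n" "0 \<le> x" "ereal x < fps_conv_radius f" "finite I"
  shows "(\<Sum>n\<in>I. fps_nth f n * x ^ n) \<le> eval_fps f x"
  unfolding eval_fps_def using assms by (intro sum_le_suminf summable_fps) auto

lemma sum_ge_if_eval_fps_greater:
  fixes f :: "real fps"
  assumes "0 \<le> x" "ereal x < fps_conv_radius f" "c < eval_fps f x"
  obtains N where "c < (\<Sum>n\<le>N. fps_nth f n * x ^ n)"
proof -
  have "(\<lambda>n. fps_nth f n * x ^ n) sums eval_fps f x"
    using assms by (intro sums_eval_fps) auto
  then have "(\<lambda>N. \<Sum>n\<le>N. fps_nth f n * x ^ n) \<longlonglongrightarrow> eval_fps f x"
    by (simp add: sums_def_le)
  from order_tendstoD(1)[OF this assms(3)] show thesis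
    using that by (auto simp: eventually_sequentially)
qed

section \<open>Sum-closed classes\<close>

locale sum_closed_class =
  fixes C :: "nat list set"
  assumes perm_class: "perm_class C" and sum_closed: "sum_closed C" and Nil_mem: "[] \<in> C"
begin

abbreviation "A \<equiv> indecomposables C"

lemma permutation_mem: "\<pi> \<in> C \<Longrightarrow> permutation \<pi>"
  using perm_class unfolding perm_class_def by blast

lemma contained_mem: "\<tau> \<in> C \<Longrightarrow> permutation \<pi> \<Longrightarrow> contains \<tau> \<pi> \<Longrightarrow> \<pi> \<in> C"
  using perm_class unfolding perm_class_def by blast

lemma lists_indecomposables: "w \<in> lists A \<Longrightarrow> w \<in> lists {\<pi>. sum_indecomposable \<pi>}"
  by (auto simp: indecomposables_def)

lemma perm_sums_mem: "w \<in> lists A \<Longrightarrow> perm_sums w \<in> C"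
proof (induction w)
  case Nil
  then show ?case by (simp add: Nil_mem)
next
  case (Cons a w)
  then show ?case using sum_closed by (simp add: sum_closed_def indecomposables_def)
qed

lemma perm_sums_memD:
  assumes "w \<in> lists {\<pi>. sum_indecomposable \<pi>}" "perm_sums w \<in> C"
  shows "w \<in> lists A"
  using assms
proof (induction w)
  case (Cons a w)
  then have "permutation a" "permutation (perm_sums w)"
    using lists_indecomposable_permutation by (auto simp: sum_indecomposable_def)
  then have "a \<in> C" "perm_sums w \<in> C"
    using contained_mem[OF Cons.prems] contains_perm_sum_left contains_perm_sum_right by simp_all
  then show ?case using Cons by (simp add: indecomposables_def)
qed simp

lemma inj_on_perm_sums_lists: "inj_on perm_sums (lists A)"
  by (rule inj_on_subset[OF inj_on_perm_sums]) (auto simp: indecomposables_def)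

text \<open>Closure under containment puts the summands of a member into \<open>A\<close>; sum
  closure gives the converse. With injectivity, \<open>C\<close> is the free monoid over
  \<open>A\<close>.\<close>

lemma perm_sums_image: "perm_sums ` lists A = C"
proof (intro equalityI subsetI)
  fix \<pi> assume \<pi>: "\<pi> \<in> C"
  obtain w where w: "w \<in> lists {\<pi>. sum_indecomposable \<pi>}" "\<pi> = perm_sums w"
    using permutation_mem[OF \<pi>] by (rule permutation_decompose)
  then have "w \<in> lists A" using \<pi> by (intro perm_sums_memD) simp_all
  with w(2) show "\<pi> \<in> perm_sums ` lists A" by (rule image_eqI)
qed (auto intro: perm_sums_mem)

sublocale word_embedding A length "\<lambda>t w. contains t (perm_sums w)"
proof
  show "0 < length a" if "a \<in> A" for a
    using that by (simp add: indecomposables_def sum_indecomposable_def)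
  show "finite {a \<in> A. length a = n}" for n
    by (rule finite_subset[of _ "permutations_of_set {1..n}"])
      (auto simp: indecomposables_def sum_indecomposable_def permutation_def)
  show "contains t (perm_sums [])" for t by simp
  have "contains (perm_sums (u @ v @ w)) (perm_sums v)" for u v w
    unfolding perm_sums_append
    by (rule contains_trans[OF contains_perm_sum_right contains_perm_sum_left])
  then show "contains t (perm_sums v)" if "contains t (perm_sums (u @ v @ w))" for t u v w
    using that contains_trans by blast
qed

lemma weight_eq_length: "weight w = length (perm_sums w)"
  by (simp add: weight_def length_perm_sums)

text \<open>Both sides satisfy the same recursion on the host, by
  \<open>contains_perm_sums_Cons_iff\<close>.\<close>

lemma hosts_iff_contains:
  assumes "\<tau> \<in> lists A" "s \<in> lists A"
  shows "hosts \<tau> s \<longleftrightarrow> contains (perm_sums \<tau>) (perm_sums s)"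
  using assms
proof (induction \<tau> arbitrary: s)
  case Nil
  then show ?case by (cases s) (auto simp: perm_sum_def dest: wt_pos)
next
  case (Cons t \<tau>)
  have IH: "hosts \<tau> v \<longleftrightarrow> contains (perm_sums \<tau>) (perm_sums v)" if "s = u @ v" for u v
    using Cons.prems that by (intro Cons.IH) simp
  have "hosts (t # \<tau>) s \<longleftrightarrow>
      (\<exists>u v. s = u @ v \<and> contains t (perm_sums u) \<and> contains (perm_sums \<tau>) (perm_sums v))"
    unfolding hosts.simps using IH by blast
  also have "\<dots> \<longleftrightarrow> contains (perm_sums (t # \<tau>)) (perm_sums s)"
    using Cons.hyps Cons.prems
    by (intro contains_perm_sums_Cons_iff[symmetric] lists_indecomposables)
      (simp_all add: indecomposables_def)
  finally show ?case .
qed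

section \<open>Avoiders and Wilf classes in terms of words\<close>

lemma of_size_class: "of_size C n = perm_sums ` words n"
  unfolding of_size_def words_def weight_eq_length using perm_sums_image by auto

lemma inj_on_perm_sums_words: "inj_on perm_sums (words n)"
  by (rule inj_on_subset[OF inj_on_perm_sums_lists]) (auto simp: words_def)

lemma card_of_size_class: "card (of_size C n) = card (words n)"
  unfolding of_size_class by (rule card_image[OF inj_on_perm_sums_words])

lemma card_of_size_avoiding:
  assumes "s \<in> lists A"
  shows "card (of_size (C \<inter> Av (perm_sums s)) n) = card (words n) - card (hosting s \<inter> words n)"
proof -
  have host: "w \<in> hosting s \<longleftrightarrow> contains (perm_sums w) (perm_sums s)" if "w \<in> words n" for w
    using that assms hosts_iff_contains by (simp add: hosting_def words_def)
  have "of_size (C \<inter> Av (perm_sums s)) n = perm_sums ` (words n - hosting s)"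
  proof -
    have "of_size (C \<inter> Av (perm_sums s)) n = {\<pi> \<in> of_size C n. \<not> contains \<pi> (perm_sums s)}"
      by (auto simp: of_size_def Av_def permutation_mem)
    also have "\<dots> = perm_sums ` {w \<in> words n. \<not> contains (perm_sums w) (perm_sums s)}"
      unfolding of_size_class by auto
    also have "{w \<in> words n. \<not> contains (perm_sums w) (perm_sums s)} = words n - hosting s"
      using host by blast
    finally show ?thesis .
  qed
  then have "card (of_size (C \<inter> Av (perm_sums s)) n) = card (words n - hosting s)"
    by (simp add: card_image inj_on_subset[OF inj_on_perm_sums_words[of n]])
  also have "\<dots> = card (words n) - card (hosting s \<inter> words n)"
    by (simp add: card_Diff_subset_Int Int_commute)
  finally show ?thesis .
qed

text \<open>Avoiders of each size are the complement of the hosts of that weight, so equal series of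
  hosts give equal numbers of avoiders.\<close>

lemma wilf_equivalenceI:
  assumes "s \<in> lists A" "s' \<in> lists A" "word_fps (hosting s) = word_fps (hosting s')"
  shows "(perm_sums s, perm_sums s') \<in> wilf_equivalence C"
proof -
  have "card (hosting s \<inter> words n) = card (hosting s' \<inter> words n)" for n
    using arg_cong[OF assms(3), of "\<lambda>f. fps_nth f n"] by (simp add: word_fps_def)
  then show ?thesis
    using assms by (simp add: wilf_equivalence_def perm_sums_mem card_of_size_avoiding)
qed

lemma equiv_wilf_equivalence: "equiv C (wilf_equivalence C)"
  by (rule equivI) (auto simp: wilf_equivalence_def refl_on_def sym_def trans_def)

text \<open>As long as the factor occurs, a swap yields an equivalent word of the same weight with a
  smaller position sum of \<open>a\<close>; this must stop.\<close>

lemma wilf_equivalent_avoiding_word: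
  assumes inc: "incompatible C a b" and x: "x \<in> A" "x \<noteq> a" and w: "w \<in> words n"
  shows "\<exists>w'\<in>words n. \<not> sublist [a, b, x, a, b, a, b] w' \<and>
    (perm_sums w, perm_sums w') \<in> wilf_equivalence C"
  using w
proof (induction "position_sum a w" arbitrary: w rule: less_induct)
  case less
  have wA: "w \<in> lists A" using less.prems by (simp add: words_def)
  show ?case
  proof (cases "sublist [a, b, x, a, b, a, b] w")
    case False
    then show ?thesis using less.prems wilf_equivalenceI[OF wA wA] by blast
  next
    case True
    then obtain p s where w: "w = p @ [a, b, x, a, b, a, b] @ s" by (auto simp: sublist_def)
    let ?w = "p @ [a, b, a, b, x, a, b] @ s"
    have ab: "\<not> contains t (perm_sums [a, b])" if "t \<in> A" for t
      using inc that by (auto simp: incompatible_def)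
    \<comment> \<open>The factor is read as \<open>a\<close>, \<open>b x a\<close>,
      \<open>b a\<close>, \<open>b\<close>, and its two middle blocks are swapped.\<close>
    have "word_fps (hosting w) = word_fps (hosting ?w)"
      using word_fps_hosting_swap[OF ab, of p "[x]" "[]" s] by (simp add: w)
    moreover have "?w \<in> lists A" using wA by (auto simp: w)
    ultimately have eqv: "(perm_sums w, perm_sums ?w) \<in> wilf_equivalence C"
      using wA by (intro wilf_equivalenceI)
    have "?w \<in> words n" using less.prems by (simp add: words_def w ac_simps)
    moreover have "position_sum a ?w < position_sum a w"
      unfolding w by (rule position_sum_swap[OF x(2)])
    ultimately obtain w' where "w' \<in> words n" "\<not> sublist [a, b, x, a, b, a, b] w'"
      "(perm_sums ?w, perm_sums w') \<in> wilf_equivalence C"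
      using less.hyps by blast
    then show ?thesis
      using eqv equiv_wilf_equivalence by (meson equivE transD)
  qed
qed

lemma num_wilf_classes_le:
  assumes "incompatible C a b" "x \<in> A" "x \<noteq> a"
  shows "num_wilf_classes C n \<le> card {w \<in> words n. \<not> sublist [a, b, x, a, b, a, b] w}"
    (is "_ \<le> card ?W")
proof -
  have "of_size C n // wilf_equivalence C \<subseteq> (\<lambda>w. wilf_equivalence C `` {perm_sums w}) ` ?W"
  proof
    fix X assume "X \<in> of_size C n // wilf_equivalence C"
    then obtain w where w: "w \<in> words n" "X = wilf_equivalence C `` {perm_sums w}"
      by (auto simp: quotient_def of_size_class)
    obtain w' where "w' \<in> ?W" "(perm_sums w, perm_sums w') \<in> wilf_equivalence C"
      using wilf_equivalent_avoiding_word[OF assms w(1)] by blast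
    then show "X \<in> (\<lambda>w. wilf_equivalence C `` {perm_sums w}) ` ?W"
      using w(2) equiv_class_eq[OF equiv_wilf_equivalence] by blast
  qed
  then have "card (of_size C n // wilf_equivalence C) \<le> card ((\<lambda>w. wilf_equivalence C `` {perm_sums w}) ` ?W)"
    by (intro card_mono) auto
  also have "\<dots> \<le> card ?W" by (rule card_image_le) simp
  finally show ?thesis by (simp add: num_wilf_classes_def)
qed

text \<open>Every nonempty permutation contains \<open>[1]\<close>. This letter makes the linear
  coefficient of the generating function positive and provides words of every weight.\<close>

lemma singleton_mem_indecomposables:
  assumes "a \<in> A"
  shows "[1] \<in> A"
proof -
  obtain h t where a: "a = h # t"
    using assms by (cases a) (auto simp: indecomposables_def sum_indecomposable_def)
  have "contains a [1]"
    unfolding contains_def by (rule exI[of _ "[h]"]) (simp add: a order_isomorphic_def)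
  moreover have "permutation [1]"
    using sum_indecomposable_1 unfolding sum_indecomposable_def by blast
  ultimately have "[1] \<in> C" using assms contained_mem by (auto simp: indecomposables_def)
  then show ?thesis using sum_indecomposable_1 by (simp add: indecomposables_def)
qed

text \<open>A member containing 21 would make 21 itself a letter; conversely, every letter of a
  permutation avoiding 21 is \<open>[1]\<close>.\<close>

lemma Av_21_if_trivial_indecomposables:
  assumes "A = {[1]}"
  shows "C = Av [2, 1]"
proof (intro equalityI subsetI)
  fix \<pi> assume \<pi>: "\<pi> \<in> C"
  have "\<not> contains \<pi> [2, 1]"
  proof
    assume "contains \<pi> [2, 1]"
    moreover have "permutation [2, 1]"
      using sum_indecomposable_21 unfolding sum_indecomposable_def by blast
    ultimately have "[2, 1] \<in> A"
      using \<pi> contained_mem sum_indecomposable_21 unfolding indecomposables_def by blast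
    then show False by (simp add: assms)
  qed
  then show "\<pi> \<in> Av [2, 1]" using \<pi> permutation_mem by (simp add: Av_def)
next
  fix \<pi> assume \<pi>: "\<pi> \<in> Av [2, 1]"
  then obtain w where w: "w \<in> lists {\<pi>. sum_indecomposable \<pi>}" "\<pi> = perm_sums w"
    using permutation_decompose[of \<pi>] by (auto simp: Av_def)
  have "a = [1]" if a: "a \<in> set w" for a
  proof (rule sum_indecomposable_avoiding_21)
    show "sum_indecomposable a" using a w by auto
    obtain u v where "w = u @ a # v" using a by (meson split_list)
    then have "contains \<pi> a"
      using contains_trans[OF contains_perm_sum_right contains_perm_sum_left] w(2) by simp
    then show "\<not> contains a [2, 1]" using \<pi> contains_trans by (auto simp: Av_def)
  qed
  then have "w \<in> lists A" by (auto simp: assms)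
  then show "\<pi> \<in> C" using perm_sums_mem w(2) by simp
qed

section \<open>Comparison of growth rates\<close>

lemma gen_fun_nth: "fps_nth (gen_fun A) n = real (card {a \<in> A. length a = n})"
  by (simp add: gen_fun_def of_size_def)

text \<open>The number of Wilf classes times \<open>x ^ n\<close> is bounded above and the number of
  members times \<open>y ^ n\<close> is bounded below by a positive constant. As
  \<open>y < x\<close>, the quotient of the two numbers is of order at most
  \<open>(y / x) ^ n\<close>.\<close>

lemma exponential_wilf_collapse:
  assumes inc: "incompatible C a b" and x: "c \<in> A" "c \<noteq> a" and super: "supercritical C"
  shows "exponential_wilf_collapse C"
proof -
  let ?f = "gen_fun A" and ?W = "[a, b, c, a, b, a, b]"
  have ab: "a \<in> A" "b \<in> A" using inc by (auto simp: incompatible_def)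
  have one: "[1] \<in> A" using ab(1) by (rule singleton_mem_indecomposables)
  have nonneg: "0 \<le> fps_nth ?f n" for n by (simp add: gen_fun_nth)
  have f0: "fps_nth ?f 0 = 0" using wt_pos by (auto simp: gen_fun_nth card_eq_0_iff)
  have "[1] \<in> {a \<in> A. length a = 1}" using one by simp
  then have f1: "0 < fps_nth ?f 1"
    unfolding gen_fun_nth of_nat_0_less_iff card_gt_0_iff using finite_letters by blast
  obtain X where X: "0 < X" "ereal X < fps_conv_radius ?f" "1 < eval_fps ?f X"
    using super by (rule supercriticalD)
  obtain x y where xy: "0 < y" "y < x" "ereal x < fps_conv_radius ?f" "1 < eval_fps ?f y"
    "eval_fps ?f x ^ length ?W - x ^ weight ?W < 1"
    using supercritical_window[OF nonneg f0 f1 X, of "length ?W" "weight ?W"] by blast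
  have radius_y: "ereal y < fps_conv_radius ?f"
    using xy(2,3) by (meson less_ereal.simps(1) less_trans)
  \<comment> \<open>Truncation leaves a finite set of letters whose weighted sum still exceeds 1, as
    the lower bound on words requires.\<close>
  obtain N where N: "1 < (\<Sum>n\<le>N. fps_nth ?f n * y ^ n)"
    using sum_ge_if_eval_fps_greater[OF _ radius_y xy(4)] xy(1) by auto
  have "replicate n [1] \<in> words n" for n
    using one by (induction n) (auto simp: words_def)
  then have "words n \<noteq> {}" for n by blast
  moreover have "1 \<le> (\<Sum>a | a \<in> A \<and> length a \<le> N. y ^ length a)"
    unfolding sum_letters_le using N by (simp add: gen_fun_nth)
  ultimately obtain \<delta> where \<delta>: "0 < \<delta>" "\<And>n. \<delta> \<le> real (card (words n)) * y ^ n"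
    using words_lower_bound[OF xy(1) _ finite_letters_le[of N]] by auto
  have "(\<Sum>a\<in>F. x ^ length a) \<le> eval_fps ?f x" if F: "finite F" "F \<subseteq> A" for F
  proof -
    define M where "M = Max (length ` F)"
    have "(\<Sum>a\<in>F. x ^ length a) \<le> (\<Sum>a | a \<in> A \<and> length a \<le> M. x ^ length a)"
      using F xy(1,2) by (intro sum_mono2 finite_letters_le) (auto simp: M_def)
    also have "\<dots> \<le> eval_fps ?f x"
      unfolding sum_letters_le gen_fun_nth[symmetric]
      using xy(1,2) by (intro sum_le_eval_fps nonneg xy(3)) auto
    finally show ?thesis .
  qed
  then obtain K where K: "\<And>n. real (card {w \<in> words n. \<not> sublist ?W w}) * x ^ n \<le> K"
    using words_avoiding_factor_upper_bound[of x ?W "eval_fps ?f x"] xy x ab by auto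
  \<comment> \<open>The midpoint between \<open>y / x\<close> and 1 leaves room for the little-o:
    \<open>(y / x / r) ^ n\<close> still tends to 0.\<close>
  define r where "r = (y / x + 1) / 2"
  have r: "0 < r" "r < 1" "y / x < r" using xy by (auto simp: r_def field_simps)
  define g where "g n = r ^ n * real (card (of_size C n))" for n
  have pos: "0 < real (card (words n)) * y ^ n" for n
    using \<delta> by (meson less_le_trans)
  have gpos: "0 < g n" for n
    using pos[of n] xy(1) r(1) by (simp add: g_def card_of_size_class zero_less_mult_iff)
  have bound: "norm (real (num_wilf_classes C n) / g n) \<le> K / \<delta> * (y / x / r) ^ n" for n
  proof -
    let ?m = "real (num_wilf_classes C n)" and ?c = "real (card (words n))"
    have "?m * x ^ n \<le> real (card {w \<in> words n. \<not> sublist ?W w}) * x ^ n"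
      using num_wilf_classes_le[OF inc x] xy(1,2) by (intro mult_right_mono) auto
    then have m: "?m * x ^ n \<le> K" using K[of n] by linarith
    have "?m / g n = (?m * x ^ n) / (?c * y ^ n) * (y / x / r) ^ n"
      using xy(1,2) r(1) by (simp add: g_def card_of_size_class power_divide field_simps)
    also have "\<dots> \<le> K / \<delta> * (y / x / r) ^ n"
      using m \<delta> xy(1,2) r(1)
      by (intro mult_right_mono frac_le) (auto intro: order_trans[OF _ m])
    finally show ?thesis using gpos[of n] by simp
  qed
  have ratio: "y / x / r < 1" using r(1,3) by (simp only: pos_divide_less_eq mult_1)
  have "(\<lambda>n. K / \<delta> * (y / x / r) ^ n) \<longlonglongrightarrow> K / \<delta> * 0"
    using ratio r(1) xy(1,2) by (intro tendsto_mult tendsto_const LIMSEQ_realpow_zero) simp_all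
  then have "(\<lambda>n. K / \<delta> * (y / x / r) ^ n) \<longlonglongrightarrow> 0" by simp
  then have "(\<lambda>n. real (num_wilf_classes C n) / g n) \<longlonglongrightarrow> 0"
    by (rule Lim_null_comparison[OF always_eventually, rotated]) (use bound in blast)
  then have "(\<lambda>n. real (num_wilf_classes C n)) \<in> o(g)"
    using gpos by (intro smalloI_tendsto) (auto simp: less_imp_neq[symmetric] intro!: always_eventually)
  then show ?thesis
    using r(1,2) unfolding exponential_wilf_collapse_def g_def by blast
qed

end

theorem theorem4p1:
  fixes C :: "nat list set"
  assumes "perm_class C"
    and "sum_closed C"
    and "supercritical C"
    and "\<exists>a b. incompatible C a b"
    and "C \<noteq> Av [2, 1]"
  shows "exponential_wilf_collapse C"
proof -
  obtain a b where inc: "incompatible C a b" using assms(4) by blast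
  then have a: "a \<in> indecomposables C" by (simp add: incompatible_def)
  then have "[] \<in> C"
    using assms(1) by (auto simp: perm_class_def indecomposables_def)
  then interpret sum_closed_class C
    using assms(1,2) by unfold_locales
  \<comment> \<open>Since \<open>[1]\<close> is always a letter, a class with \<open>a\<close> as
    its only letter has \<open>a = [1]\<close> and consists of the increasing permutations.\<close>
  obtain c where "c \<in> indecomposables C" "c \<noteq> a"
  proof (rule ccontr)
    assume "\<not> thesis"
    then have "indecomposables C = {a}" using a that by blast
    then have "indecomposables C = {[1]}" using singleton_mem_indecomposables[OF a] by auto
    then show False using Av_21_if_trivial_indecomposables assms(5) by blast
  qed
  with inc assms(3) show ?thesis by (intro exponential_wilf_collapse)
qed

end
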